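(* Let $b\geq 1$ and let $n,m$ be positive integers. Then there exists an $nm$-fold colouring of $G_{[1,b]}$ with $$\Big\lceil\Big(\tfrac{2b}{\sqrt{3}}+1\Big) n\Big\rceil\cdot \Big\lceil\Big(\tfrac{2b}{\sqrt{3}}+1\Big) m\Big\rceil$$ colours; in particular $\frac{\chi_{nm}(G_{[1,b]})}{nm}\leq \frac{\lceil(2b/\sqrt{3}+1) n\rceil\cdot\lceil(2b/\sqrt{3}+1) m\rceil}{nm}$.
   Context: For $b\ge 1$, $G_{[1,b]}$ is the graph with vertex set $\mathbb{R}^2$ in which two points are adjacent if and only if their Euclidean distance $d$ satisfies $1\leq d\leq b$. For positive integers $j\le k$, a $j$-fold colouring of a graph $G=(V,E)$ with $k$ colours is a map $f$ assigning to each vertex a $j$-element subset of $\{1,\dots,k\}$ such that $f(v)\cap f(w)=\emptyset$ whenever $v,w$ are adjacent; $\chi_j(G)$ is the least such $k$. *)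

theory Defs
  imports "HOL-Analysis.Analysis"
begin

record 'v graph =
  vertices :: "'v set"
  adjacent :: "'v \<Rightarrow> 'v \<Rightarrow> bool"

definition distance_graph :: "real \<Rightarrow> (real ^ 2) graph" where
  "distance_graph b = \<lparr> vertices = UNIV, adjacent = (\<lambda>x y. 1 \<le> dist x y \<and> dist x y \<le> b) \<rparr>"

definition fold_colouring :: "'v graph \<Rightarrow> nat \<Rightarrow> nat \<Rightarrow> ('v \<Rightarrow> nat set) \<Rightarrow> bool" where
  "fold_colouring G j k f \<longleftrightarrow>
     1 \<le> j \<and> j \<le> k \<and>
     (\<forall>v\<in>vertices G. f v \<subseteq> {1..k} \<and> card (f v) = j) \<and>
     (\<forall>v\<in>vertices G. \<forall>w\<in>vertices G. adjacent G v w \<longrightarrow> f v \<inter> f w = {})"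

text \<open>The value is meaningful only if some \<open>j\<close>-fold colouring of \<open>G\<close> with finitely many colours exists.\<close>

definition fold_chromatic_number :: "nat \<Rightarrow> 'v graph \<Rightarrow> nat" where
  "fold_chromatic_number j G = (LEAST k. \<exists>f. fold_colouring G j k f)"

end

(* Tile the plane by half-open hexagons of diameter 1, centred at the lattice spanned by two vectors
   u, v of length sqrt 3 / 2 at an angle of 60 degrees, and superimpose the n m translates of this
   tiling by (i / n) u + (j / m) v. The hexagon centred at (a / n) u + (d / m) v gets the colour
   (a mod N, d mod M), and a point gets the colours of the n m hexagons containing it. Distinct
   hexagons of the same colour are separated by more than b in one of the three directions orthogonal
   to the sides, since N / n and M / m are at least 2 b / sqrt 3 + 1, while two points of one hexagon
   are at distance less than 1 because opposite sides never both belong to it. *)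
theory Submission
  imports Defs
begin

text \<open>The inner products of \<open>x\<close> with the unit vectors at angles 0 and 60 degrees, scaled by
  \<open>2 / sqrt 3\<close>; the one at 120 degrees is the difference \<open>hex_q x - hex_p x\<close>. In these coordinates
  \<open>u = (1, 1/2)\<close> and \<open>v = (1/2, 1)\<close>.\<close>

definition hex_p :: "real ^ 2 \<Rightarrow> real" where
  "hex_p x = 2 * x $ 1 / sqrt 3"

definition hex_q :: "real ^ 2 \<Rightarrow> real" where
  "hex_q x = x $ 2 + x $ 1 / sqrt 3"

text \<open>The centre is s u + t v, with real s and t so as to cover all translates. Half-open
  intervals keep the three coordinate differences of two members strictly below 1 in absolute
  value.\<close>

definition half_open_hexagon :: "real \<Rightarrow> real \<Rightarrow> (real ^ 2) set" where
  "half_open_hexagon s t = {x.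
     hex_p x - (s + t / 2) \<in> {-1/2..<1/2} \<and>
     hex_q x - (s / 2 + t) \<in> {-1/2..<1/2} \<and>
     (hex_q x - (s / 2 + t)) - (hex_p x - (s + t / 2)) \<in> {-1/2..<1/2}}"

lemma dist_hex:
  "(dist x y)\<^sup>2 = (hex_p x - hex_p y)\<^sup>2 - (hex_p x - hex_p y) * (hex_q x - hex_q y)
                 + (hex_q x - hex_q y)\<^sup>2"
proof -
  define X Y where "X = (x $ 1 - y $ 1) / sqrt 3" and "Y = x $ 2 - y $ 2"
  have p: "hex_p x - hex_p y = 2 * X" and q: "hex_q x - hex_q y = Y + X"
    by (simp_all add: hex_p_def hex_q_def X_def Y_def diff_divide_distrib)
  have "(dist x y)\<^sup>2 = (x $ 1 - y $ 1)\<^sup>2 + (x $ 2 - y $ 2)\<^sup>2"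
    by (simp add: dist_vec_def L2_set_def sum_2 dist_real_def real_sqrt_pow2)
  also have "\<dots> = 3 * X\<^sup>2 + Y\<^sup>2"
    by (simp add: X_def Y_def power_divide)
  finally show ?thesis
    unfolding p q by (simp add: power2_eq_square algebra_simps)
qed

text \<open>Cauchy-Schwarz for the three scaled unit vectors, done by completing the square: the
  quadratic form is 3/4 z^2 + w^2 for each of z = P, Q, Q - P.\<close>

lemma hex_le_dist:
  assumes "dist x y \<le> b"
  shows "\<bar>hex_p x - hex_p y\<bar> \<le> 2 * b / sqrt 3"
    and "\<bar>hex_q x - hex_q y\<bar> \<le> 2 * b / sqrt 3"
    and "\<bar>(hex_q x - hex_q y) - (hex_p x - hex_p y)\<bar> \<le> 2 * b / sqrt 3"
proof -
  define P Q where "P = hex_p x - hex_p y" and "Q = hex_q x - hex_q y"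
  have b: "0 \<le> b" using assms zero_le_dist[of x y] by linarith
  have le: "P\<^sup>2 - P * Q + Q\<^sup>2 \<le> b\<^sup>2"
    unfolding P_def Q_def dist_hex[symmetric] by (intro power_mono assms) simp
  have bound: "\<bar>z\<bar> \<le> 2 * b / sqrt 3" if "P\<^sup>2 - P * Q + Q\<^sup>2 = 3/4 * z\<^sup>2 + w\<^sup>2" for z w :: real
  proof -
    have "3/4 * z\<^sup>2 \<le> b\<^sup>2" using le that zero_le_power2[of w] by linarith
    hence "z\<^sup>2 \<le> (2 * b / sqrt 3)\<^sup>2" by (simp add: power_divide power_mult_distrib)
    thus ?thesis using b by (auto intro: power2_le_imp_le simp: abs_le_square_iff)
  qed
  show "\<bar>hex_p x - hex_p y\<bar> \<le> 2 * b / sqrt 3"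
    using bound[of P "Q - P / 2"] unfolding P_def[symmetric]
    by (simp add: power2_eq_square algebra_simps)
  show "\<bar>hex_q x - hex_q y\<bar> \<le> 2 * b / sqrt 3"
    using bound[of Q "P - Q / 2"] unfolding Q_def[symmetric]
    by (simp add: power2_eq_square algebra_simps)
  show "\<bar>(hex_q x - hex_q y) - (hex_p x - hex_p y)\<bar> \<le> 2 * b / sqrt 3"
    using bound[of "Q - P" "(P + Q) / 2"] unfolding P_def[symmetric] Q_def[symmetric]
    by (simp add: power2_eq_square field_simps)
qed

text \<open>The form is (Q - P)^2 + P Q, hence at most (Q - P)^2 if P Q \<le> 0. If the signs agree,
  the smaller of P^2 and Q^2 is at most P Q, and the form is at most the other.\<close>

lemma hexagonal_form_less_1:
  fixes P Q :: real
  assumes "\<bar>P\<bar> < 1" "\<bar>Q\<bar> < 1" "\<bar>Q - P\<bar> < 1"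
  shows "P\<^sup>2 - P * Q + Q\<^sup>2 < 1"
proof -
  have sq: "P\<^sup>2 < 1" "Q\<^sup>2 < 1" "(Q - P)\<^sup>2 < 1"
    using assms by (simp_all add: abs_square_less_1)
  consider "P * Q \<le> 0" | "P\<^sup>2 \<le> P * Q" | "Q\<^sup>2 \<le> P * Q"
  proof (cases "P * Q \<le> 0")
    case False
    then have "0 < P \<and> 0 < Q \<or> P < 0 \<and> Q < 0"
      by (simp add: not_le zero_less_mult_iff)
    then have "0 \<le> P * (Q - P) \<or> 0 \<le> Q * (P - Q)"
      by (simp add: zero_le_mult_iff) linarith
    then show ?thesis using that by (auto simp: power2_eq_square algebra_simps)
  qed
  then show ?thesis
    using sq by cases (auto simp: power2_eq_square algebra_simps)
qed

lemma dist_half_open_hexagon: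
  assumes "x \<in> half_open_hexagon s t" "y \<in> half_open_hexagon s t"
  shows "dist x y < 1"
proof -
  have "(dist x y)\<^sup>2 < 1\<^sup>2"
    unfolding dist_hex one_power2
    by (rule hexagonal_form_less_1) (use assms in \<open>auto simp: half_open_hexagon_def\<close>)
  then show ?thesis by (rule power2_less_imp_less) simp
qed

text \<open>Modulo the lattice, x lies in the parallelogram spanned by u and v, and a hexagon at one
  of its four corners contains it.\<close>

lemma half_open_hexagon_cover:
  "\<exists>(k :: int) (l :: int). x \<in> half_open_hexagon (s + k) (t + l)"
proof -
  \<comment> \<open>Inverting p = a + b / 2, q = a / 2 + b gives the coordinates of x in the basis
    u, v.\<close>
  define \<alpha> where "\<alpha> = (4 * hex_p x - 2 * hex_q x) / 3 - s"
  define \<beta> where "\<beta> = (4 * hex_q x - 2 * hex_p x) / 3 - t"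
  define A where "A = \<alpha> - \<lfloor>\<alpha>\<rfloor>"
  define B where "B = \<beta> - \<lfloor>\<beta>\<rfloor>"
  have A: "0 \<le> A" "A < 1" and B: "0 \<le> B" "B < 1" unfolding A_def B_def by linarith+
  have p: "hex_p x = (s + \<lfloor>\<alpha>\<rfloor> + A) + (t + \<lfloor>\<beta>\<rfloor> + B) / 2"
   and q: "hex_q x = (s + \<lfloor>\<alpha>\<rfloor> + A) / 2 + (t + \<lfloor>\<beta>\<rfloor> + B)"
    by (simp_all add: A_def B_def \<alpha>_def \<beta>_def field_simps)
  have mem: "x \<in> half_open_hexagon (s + of_int (\<lfloor>\<alpha>\<rfloor> + k)) (t + of_int (\<lfloor>\<beta>\<rfloor> + l)) \<longleftrightarrow>
      2 * (A - k) + (B - l) \<in> {-1..<1} \<and> (A - k) + 2 * (B - l) \<in> {-1..<1} \<and>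
      (B - l) - (A - k) \<in> {-1..<1}" for k l :: int
    unfolding half_open_hexagon_def mem_Collect_eq p q atLeastLessThan_iff of_int_add
    by argo
  \<comment> \<open>The corners are (0,0), (1,1), (1,0), (0,1) in this order. Between the last two,
    half-openness sends the tie A = B to (0,1).\<close>
  consider "2 * A + B < 1" "A + 2 * B < 1" | "2 * A + B \<ge> 2" "A + 2 * B \<ge> 2"
    | "B < A" "1 \<le> 2 * A + B" "A + 2 * B < 2" | "A \<le> B" "2 * A + B < 2" "1 \<le> A + 2 * B"
    by linarith
  then show ?thesis
  proof cases
    case 1
    show ?thesis using mem[of 0 0] 1 A B by (auto intro!: exI)
  next
    case 2
    show ?thesis
      by (rule exI[of _ "\<lfloor>\<alpha>\<rfloor> + 1"], rule exI[of _ "\<lfloor>\<beta>\<rfloor> + 1"], unfold mem) (use 2 A B in auto)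
  next
    case 3
    show ?thesis
      by (rule exI[of _ "\<lfloor>\<alpha>\<rfloor> + 1"], rule exI[of _ "\<lfloor>\<beta>\<rfloor> + 0"], unfold mem) (use 3 A B in auto)
  next
    case 4
    show ?thesis
      by (rule exI[of _ "\<lfloor>\<alpha>\<rfloor> + 0"], rule exI[of _ "\<lfloor>\<beta>\<rfloor> + 1"], unfold mem) (use 4 A B in auto)
  qed
qed

text \<open>If k and l have opposite signs, their terms reinforce each other in the third
  expression, which is at least c / 2 + c / 2. Otherwise nothing cancels in the first two: the first
  suffices if k \<noteq> 0, the second if k = 0.\<close>

lemma hexagonal_lattice_separated:
  fixes k l :: int and c \<sigma> \<tau> :: real
  assumes c: "0 \<le> c" "c \<le> \<sigma>" "c \<le> \<tau>" and nz: "k \<noteq> 0 \<or> l \<noteq> 0"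
  shows "c \<le> \<bar>k * \<sigma> + l * \<tau> / 2\<bar> \<or> c \<le> \<bar>k * \<sigma> / 2 + l * \<tau>\<bar> \<or>
    c \<le> \<bar>(k * \<sigma> / 2 + l * \<tau>) - (k * \<sigma> + l * \<tau> / 2)\<bar>"
proof -
  have multiple: "i * r = 0 \<and> i = 0 \<or> c \<le> i * r \<and> 0 < i \<or> i * r \<le> - c \<and> i < 0"
    if "c \<le> r" for i :: int and r :: real
  proof -
    have r: "0 \<le> r" using c that by simp
    consider "i = 0" | "1 \<le> i" | "i \<le> -1" by linarith
    then show ?thesis
    proof cases
      case 2
      then have "1 * r \<le> i * r" by (intro mult_right_mono r) simp
      then show ?thesis using 2 that by simp
    next
      case 3
      then have "i * r \<le> (-1) * r" by (intro mult_right_mono r) linarith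
      then show ?thesis using 3 that by simp
    qed simp
  qed
  show ?thesis
    using multiple[OF c(2), of k] multiple[OF c(3), of l] nz c(1)
    by (elim disjE conjE) linarith+
qed

text \<open>Points within b differ by at most c - 1 in each coordinate, and their offsets from the
  centres differ by less than 1. The centres would then differ by less than c in all three, against
  the separation.\<close>

lemma half_open_hexagons_far:
  fixes b c \<sigma> \<tau> :: real and k l :: int
  defines "c \<equiv> 2 * b / sqrt 3 + 1"
  assumes b: "0 \<le> b" and "c \<le> \<sigma>" "c \<le> \<tau>" and nz: "k \<noteq> 0 \<or> l \<noteq> 0"
    and x: "x \<in> half_open_hexagon (s + k * \<sigma>) (t + l * \<tau>)"
    and y: "y \<in> half_open_hexagon s t"
  shows "b < dist x y"
proof (rule ccontr)
  assume "\<not> b < dist x y"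
  then have "dist x y \<le> b" by simp
  note d = hex_le_dist[OF this]
  have c: "2 * b / sqrt 3 = c - 1" by (simp add: c_def)
  have "0 \<le> c" using b by (simp add: c_def)
  note sep = hexagonal_lattice_separated[OF this assms(3,4) nz]
  have less: "\<bar>z\<bar> < c" if "\<bar>w\<bar> \<le> c - 1" "\<bar>w - z\<bar> < 1" for w z :: real
    using that by linarith
  note x = x[unfolded half_open_hexagon_def mem_Collect_eq atLeastLessThan_iff]
    and y = y[unfolded half_open_hexagon_def mem_Collect_eq atLeastLessThan_iff]
  have "\<bar>k * \<sigma> + l * \<tau> / 2\<bar> < c"
    by (rule less[OF d(1)[unfolded c]]) (use x y in argo)
  moreover have "\<bar>k * \<sigma> / 2 + l * \<tau>\<bar> < c"
    by (rule less[OF d(2)[unfolded c]]) (use x y in argo)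
  moreover have "\<bar>(k * \<sigma> / 2 + l * \<tau>) - (k * \<sigma> + l * \<tau> / 2)\<bar> < c"
    by (rule less[OF d(3)[unfolded c]]) (use x y in argo)
  ultimately show False using sep by linarith
qed

text \<open>Mixed-radix coding of two residues as one number: reduction modulo N recovers the low
  digit.\<close>

lemma mod_add_mult_inject:
  fixes a a' d d' N M :: int
  assumes "0 < N"
    and eq: "a mod N + N * (d mod M) = a' mod N + N * (d' mod M)"
  shows "a mod N = a' mod N" "d mod M = d' mod M"
proof -
  have "(a mod N + N * (d mod M)) mod N = (a' mod N + N * (d' mod M)) mod N"
    using eq by simp
  then show "a mod N = a' mod N" by simp
  then show "d mod M = d' mod M" using eq \<open>0 < N\<close> by simp
qed

lemma fold_colouring_distance_graph:
  fixes b :: real and n m :: nat and N M :: int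
  assumes b: "1 \<le> b" and n: "1 \<le> n" and m: "1 \<le> m"
    and N: "(2 * b / sqrt 3 + 1) * n \<le> N" and M: "(2 * b / sqrt 3 + 1) * m \<le> M"
  shows "\<exists>f. fold_colouring (distance_graph b) (n * m) (nat (N * M)) f"
proof -
  define cell where "cell a d = half_open_hexagon (of_int a / n) (of_int d / m)" for a d :: int
  define colour where "colour = (\<lambda>(a, d). nat (1 + (a mod N + N * (d mod M))))"
  have c1: "1 \<le> 2 * b / sqrt 3 + 1" using b by simp
  have nN: "int n \<le> N" and mM: "int m \<le> M"
    using order_trans[OF mult_right_mono[OF c1] N] order_trans[OF mult_right_mono[OF c1] M]
    by simp_all
  then have N0: "0 < N" and M0: "0 < M" using n m by linarith+
  \<comment> \<open>Centres of equally coloured cells differ by multiples of N / n along u and of M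
    / m along v.\<close>
  have \<sigma>: "2 * b / sqrt 3 + 1 \<le> N / n" and \<tau>: "2 * b / sqrt 3 + 1 \<le> M / m"
    using N M n m by (simp_all add: pos_le_divide_eq)

  have colour_nonneg: "0 \<le> a mod N + N * (d mod M)" for a d
    using N0 M0 by simp
  have far: "b < dist x y"
    if x: "x \<in> cell a d" and y: "y \<in> cell a' d'"
      and col: "colour (a, d) = colour (a', d')" and ne: "(a, d) \<noteq> (a', d')"
    for x y a d a' d'
  proof -
    have "a mod N + N * (d mod M) = a' mod N + N * (d' mod M)"
      using col colour_nonneg[of a d] colour_nonneg[of a' d'] by (simp add: colour_def)
    note eq = mod_add_mult_inject[OF N0 this]
    obtain k where k: "a = a' + N * k"
      by (rule mod_eqE[OF eq(1)[symmetric]])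
    obtain l where l: "d = d' + M * l"
      by (rule mod_eqE[OF eq(2)[symmetric]])
    have "k \<noteq> 0 \<or> l \<noteq> 0" using ne k l by auto
    moreover have "x \<in> half_open_hexagon (a' / n + k * (N / n)) (d' / m + l * (M / m))"
      using x by (simp add: cell_def k l add_divide_distrib mult.commute)
    ultimately show ?thesis
      using half_open_hexagons_far[OF _ \<sigma> \<tau>] y b by (simp add: cell_def)
  qed

  \<comment> \<open>A lattice step along u adds n to the first index, one along v adds m to the
    second, so each translate (i, j) supplies a cell around x.\<close>
  have "\<exists>(k :: int) (l :: int). x \<in> cell (int i + int n * k) (int j + int m * l)" for x i j
    using half_open_hexagon_cover[of x "i / n" "j / m"] n m
    by (simp add: cell_def add_divide_distrib)
  then obtain K L where KL: "\<And>x i j. x \<in> cell (int i + int n * K x i j) (int j + int m * L x i j)"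
    by metis
  define index where "index x = (\<lambda>(i, j). (int i + int n * K x i j, int j + int m * L x i j))" for x
  define f where "f x = colour ` index x ` ({..<n} \<times> {..<m})" for x
  have index_cell: "x \<in> cell a d" if "(a, d) \<in> range (index x)" for x a d
    using that KL by (auto simp: index_def)

  have "card (f x) = n * m" for x
  proof -
    \<comment> \<open>The residues of the index modulo n and m recover i < n and j < m.\<close>
    have "inj_on (index x) ({..<n} \<times> {..<m})"
    proof (rule inj_onI)
      fix u v
      assume u: "u \<in> {..<n} \<times> {..<m}" and v: "v \<in> {..<n} \<times> {..<m}" and eq: "index x u = index x v"
      obtain i j i' j' where ij: "u = (i, j)" "v = (i', j')" by (metis surj_pair)
      from eq have "(int i + int n * K x i j) mod n = (int i' + int n * K x i' j') mod n"
        "(int j + int m * L x i j) mod m = (int j' + int m * L x i' j') mod m"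
        by (simp_all add: index_def ij)
      then show "u = v" using u v by (simp add: ij)
    qed
    moreover have "inj_on colour (range (index x))"
    proof (rule inj_onI, rule ccontr)
      fix u v assume *: "u \<in> range (index x)" "v \<in> range (index x)" "colour u = colour v" "u \<noteq> v"
      \<comment> \<open>Both cells contain x, so \<open>far\<close> applies to x paired with
        itself.\<close>
      have "b < dist x x"
        using far[of x "fst u" "snd u" x "fst v" "snd v"] * index_cell by simp
      then show False using b by simp
    qed
    ultimately show ?thesis
      unfolding f_def by (subst card_image) (auto intro: inj_on_subset simp: card_image)
  qed
  moreover have "f x \<subseteq> {1..nat (N * M)}" for x
  proof -
    have "colour (a, d) \<in> {1..nat (N * M)}" for a d
    proof -
      \<comment> \<open>The largest code is (N - 1) + N (M - 1) = N M - 1; the added 1 makes the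
        colours start at 1.\<close>
      have "N * (d mod M) \<le> N * (M - 1)"
        using pos_mod_bound[OF M0, of d] N0 by (intro mult_left_mono) auto
      then have "1 + (a mod N + N * (d mod M)) \<le> N * M"
        using pos_mod_bound[OF N0, of a] by (simp add: algebra_simps)
      then show ?thesis using colour_nonneg[of a d] by (auto simp: colour_def)
    qed
    then show ?thesis by (force simp: f_def index_def)
  qed
  moreover have "f x \<inter> f y = {}" if adj: "1 \<le> dist x y" "dist x y \<le> b" for x y
  proof (rule ccontr)
    assume "f x \<inter> f y \<noteq> {}"
    then obtain u v where uv: "u \<in> range (index x)" "v \<in> range (index y)" "colour u = colour v"
      unfolding f_def by blast
    have cells: "x \<in> cell (fst u) (snd u)" "y \<in> cell (fst v) (snd v)"
      using uv index_cell by simp_all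
    show False
    proof (cases "u = v")
      case True
      then show False
        using dist_half_open_hexagon cells adj unfolding cell_def by fastforce
    next
      case False
      then show False using far[OF cells] uv(3) adj by simp
    qed
  qed
  moreover have "1 \<le> n * m" using n m by simp
  moreover have "n * m \<le> nat (N * M)"
    using nat_mono[OF mult_mono[OF nN mM]] N0 by (simp add: nat_mult_distrib)
  ultimately have "fold_colouring (distance_graph b) (n * m) (nat (N * M)) f"
    unfolding fold_colouring_def distance_graph_def by simp
  then show ?thesis by blast
qed

theorem theorem6:
  fixes b :: real and n m :: nat
  assumes "b \<ge> 1" and "n \<ge> 1" and "m \<ge> 1"
  shows "(\<exists>f. fold_colouring (distance_graph b) (n * m)
            (nat (\<lceil>(2 * b / sqrt 3 + 1) * real n\<rceil> * \<lceil>(2 * b / sqrt 3 + 1) * real m\<rceil>)) f)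
       \<and> real (fold_chromatic_number (n * m) (distance_graph b)) / real (n * m)
           \<le> real_of_int (\<lceil>(2 * b / sqrt 3 + 1) * real n\<rceil> * \<lceil>(2 * b / sqrt 3 + 1) * real m\<rceil>)
               / real (n * m)"
    (is "(\<exists>f. fold_colouring _ _ (nat (?N * ?M)) f) \<and> _")
proof
  show colouring: "\<exists>f. fold_colouring (distance_graph b) (n * m) (nat (?N * ?M)) f"
    using assms by (intro fold_colouring_distance_graph le_of_int_ceiling)
  have "fold_chromatic_number (n * m) (distance_graph b) \<le> nat (?N * ?M)"
    unfolding fold_chromatic_number_def by (rule Least_le) (rule colouring)
  \<comment> \<open>Since \<open>nat\<close> sends negative integers to 0, the sign is checked
    before passing to reals.\<close>
  moreover have "0 \<le> ?N * ?M"
    using assms by (intro mult_nonneg_nonneg) (simp_all add: less_le_trans[OF _ mult_nonneg_nonneg])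
  ultimately show "real (fold_chromatic_number (n * m) (distance_graph b)) / real (n * m)
      \<le> real_of_int (?N * ?M) / real (n * m)"
    by (intro divide_right_mono) linarith+
qed

end
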